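(* Let $(\mathfrak{g},[\cdot,\cdot],\omega)$ be a symplectic Lie algebra over $\mathbb{K}$. Then its Levi-Civita product $\bullet$ is given by $$\omega(u\bullet v,w)=\omega(u,[v,w])\qquad\text{for all }u,v,w\in\mathfrak{g}.$$ In particular, $u\bullet v=-v\cdot u$ for all $u,v\in\mathfrak{g}$, where $\cdot$ is the left-symmetric product associated with the symplectic Lie algebra. Moreover, $(\mathfrak{g},\bullet)$ is a right-symmetric algebra.
   Context: $\mathbb{K}$ is a field of characteristic $0$; all vector spaces are finite-dimensional. A symplectic Lie algebra is a Lie algebra $\mathfrak{g}$ with a nondegenerate skew-symmetric bilinear form $\omega$ satisfying $\omega([u,v],w)+\omega([v,w],u)+\omega([w,u],v)=0$ for all $u,v,w$. The Levi-Civita product of a Lie algebra with nondegenerate skew-symmetric form $\omega$ is the unique bilinear product $\bullet$ with $u\bullet v-v\bullet u=[u,v]$ and $\omega(u\bullet v,w)=\omega(v,u\bullet w)$; equivalently $2\omega(u\bullet v,w)=\omega([u,v],w)-\omega([v,w],u)+\omega([w,u],v)$. The left-symmetric product associated with the symplectic Lie algebra is the product $\cdot$ defined by $\omega(u\cdot v,w)=-\omega(v,[u,w])$ for all $u,v,w$; it is known to be left-symmetric with $u\cdot v-v\cdot u=[u,v]$. With associator $(u,v,w)=(u\bullet v)\bullet w-u\bullet(v\bullet w)$, an algebra is left-symmetric if $(u,v,w)=(v,u,w)$ and right-symmetric if $(u,v,w)=(u,w,v)$ for all $u,v,w$. *)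

theory Defs
  imports Complex_Main
begin

definition bilinear_map ::
  "('k::field \<Rightarrow> 'a::ab_group_add \<Rightarrow> 'a) \<Rightarrow> ('k \<Rightarrow> 'b::ab_group_add \<Rightarrow> 'b) \<Rightarrow>
   ('k \<Rightarrow> 'c::ab_group_add \<Rightarrow> 'c) \<Rightarrow> ('a \<Rightarrow> 'b \<Rightarrow> 'c) \<Rightarrow> bool" where
  "bilinear_map s1 s2 s3 B \<longleftrightarrow>
     (\<forall>u. Vector_Spaces.linear s2 s3 (B u)) \<and> (\<forall>v. Vector_Spaces.linear s1 s3 (\<lambda>u. B u v))"

locale fin_dim_algebra = vector_space scale
  for scale :: "'k::field_char_0 \<Rightarrow> 'v::ab_group_add \<Rightarrow> 'v" +
  fixes mult :: "'v \<Rightarrow> 'v \<Rightarrow> 'v"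
  assumes finite_dim: "\<exists>B. finite_dimensional_vector_space scale B"
    and bilinear_mult: "bilinear_map scale scale scale mult"

definition associator :: "('v::ab_group_add \<Rightarrow> 'v \<Rightarrow> 'v) \<Rightarrow> 'v \<Rightarrow> 'v \<Rightarrow> 'v \<Rightarrow> 'v" where
  "associator mult u v w = mult (mult u v) w - mult u (mult v w)"

locale right_symmetric_algebra = fin_dim_algebra scale mult
  for scale :: "'k::field_char_0 \<Rightarrow> 'v::ab_group_add \<Rightarrow> 'v" and mult +
  assumes right_symmetric: "associator mult u v w = associator mult u w v"

locale lie_algebra = fin_dim_algebra scale bracket
  for scale :: "'k::field_char_0 \<Rightarrow> 'v::ab_group_add \<Rightarrow> 'v" and bracket +
  assumes bracket_self: "bracket u u = 0"
    and jacobi: "bracket u (bracket v w) + bracket v (bracket w u) + bracket w (bracket u v) = 0"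

locale lie_algebra_with_skew_form = lie_algebra scale bracket
  for scale :: "'k::field_char_0 \<Rightarrow> 'v::ab_group_add \<Rightarrow> 'v" and bracket +
  fixes \<omega> :: "'v \<Rightarrow> 'v \<Rightarrow> 'k"
  assumes bilinear_form: "bilinear_map scale scale (*) \<omega>"
    and skew: "\<omega> u v = - \<omega> v u"
    and nondegenerate: "(\<And>v. \<omega> u v = 0) \<Longrightarrow> u = 0"

locale symplectic_lie_algebra = lie_algebra_with_skew_form scale bracket \<omega>
  for scale :: "'k::field_char_0 \<Rightarrow> 'v::ab_group_add \<Rightarrow> 'v" and bracket and \<omega> +
  assumes closed: "\<omega> (bracket u v) w + \<omega> (bracket v w) u + \<omega> (bracket w u) v = 0"

definition is_levi_civita_product ::
  "('k::field_char_0 \<Rightarrow> 'v::ab_group_add \<Rightarrow> 'v) \<Rightarrow> ('v \<Rightarrow> 'v \<Rightarrow> 'v) \<Rightarrow> ('v \<Rightarrow> 'v \<Rightarrow> 'k) \<Rightarrow>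
   ('v \<Rightarrow> 'v \<Rightarrow> 'v) \<Rightarrow> bool" where
  "is_levi_civita_product scale bracket \<omega> p \<longleftrightarrow>
     bilinear_map scale scale scale p \<and>
     (\<forall>u v. p u v - p v u = bracket u v) \<and>
     (\<forall>u v w. \<omega> (p u v) w = \<omega> v (p u w))"

text \<open>The description operator denotes in every \<open>lie_algebra_with_skew_form\<close>, by
  \<open>ex1_levi_civita_product\<close> below; likewise for the left-symmetric product, by
  \<open>ex1_left_symmetric_product\<close>.\<close>

definition levi_civita_product ::
  "('k::field_char_0 \<Rightarrow> 'v::ab_group_add \<Rightarrow> 'v) \<Rightarrow> ('v \<Rightarrow> 'v \<Rightarrow> 'v) \<Rightarrow> ('v \<Rightarrow> 'v \<Rightarrow> 'k) \<Rightarrow>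
   'v \<Rightarrow> 'v \<Rightarrow> 'v" where
  "levi_civita_product scale bracket \<omega> = (THE p. is_levi_civita_product scale bracket \<omega> p)"

definition left_symmetric_product ::
  "('v::ab_group_add \<Rightarrow> 'v \<Rightarrow> 'v) \<Rightarrow> ('v \<Rightarrow> 'v \<Rightarrow> 'k::field_char_0) \<Rightarrow> 'v \<Rightarrow> 'v \<Rightarrow> 'v" where
  "left_symmetric_product bracket \<omega> =
     (THE p. \<forall>u v w. \<omega> (p u v) w = - \<omega> v (bracket u w))"

context lie_algebra_with_skew_form
begin

lemma linear_facts:
  shows "\<omega> (u + v) w = \<omega> u w + \<omega> v w" "\<omega> u (v + w) = \<omega> u v + \<omega> u w"
    and "\<omega> (scale c u) w = c * \<omega> u w" "\<omega> u (scale c w) = c * \<omega> u w"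
    and "bracket (u + v) w = bracket u w + bracket v w" "bracket u (v + w) = bracket u v + bracket u w"
    and "bracket (scale c u) w = scale c (bracket u w)" "bracket u (scale c w) = scale c (bracket u w)"
  using bilinear_form bilinear_mult
  by (auto simp: bilinear_map_def Vector_Spaces.linear_def module_hom_def module_hom_axioms_def)

lemma form_diff: "\<omega> (u - v) w = \<omega> u w - \<omega> v w"
  using linear_facts(1)[of "u - v" v w] by (simp add: algebra_simps)

lemma eqI: "(\<And>w. \<omega> u w = \<omega> v w) \<Longrightarrow> u = v"
  using nondegenerate[of "u - v"] by (simp add: form_diff)

lemma linearI:
  assumes "\<And>x y. f (x + y) = f x + f y" "\<And>c x. f (scale c x) = c * f x"
  shows "Vector_Spaces.linear scale (*) f"
  using assms vector_space_axioms
  by (auto simp: Vector_Spaces.linear_def module_hom_def module_hom_axioms_def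
      module_iff_vector_space vector_space_def algebra_simps)

lemma riesz:
  assumes f: "Vector_Spaces.linear scale (*) f"
  shows "\<exists>x. \<forall>w. \<omega> x w = f w"
proof -
  from finite_dim obtain B where "finite_dimensional_vector_space scale B" by blast
  then interpret B: finite_dimensional_vector_space scale B .
  interpret vp: vector_space_pair scale "(*)"
    using f by (auto simp: vector_space_pair_def Vector_Spaces.linear_def)
  define T where "T u = (\<Sum>b\<in>B. scale (\<omega> u b) b)" for u
  have coord: "\<forall>b\<in>B. g b = h b"
    if "(\<Sum>b\<in>B. scale (g b) b) = (\<Sum>b\<in>B. scale (h b) b)" for g h
  proof -
    have "(\<Sum>b\<in>B. scale (g b - h b) b) = 0"
      using that by (simp add: scale_left_diff_distrib sum_subtractf)
    then show ?thesis
      using independentD[OF B.independent_Basis B.finite_Basis order_refl, of "\<lambda>b. g b - h b"]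
      by auto
  qed
  have lin: "Vector_Spaces.linear scale (*) (\<omega> x)" for x
    by (rule linearI) (simp_all add: linear_facts)
  have ext: "g w = h w"
    if "Vector_Spaces.linear scale (*) g" "Vector_Spaces.linear scale (*) h" "\<forall>b\<in>B. g b = h b"
    for g h w
    using vp.linear_eq_on[OF that(1,2), of w B] that(3) B.span_Basis by auto
  have "Vector_Spaces.linear scale scale T"
    using vector_space_axioms
    by (auto simp: T_def Vector_Spaces.linear_def module_hom_def module_hom_axioms_def
        module_iff_vector_space linear_facts scale_left_distrib sum.distrib scale_sum_right)
  moreover have "inj T"
  proof (rule injI)
    fix x y assume "T x = T y"
    then have "\<forall>b\<in>B. \<omega> x b = \<omega> y b" unfolding T_def by (rule coord)
    then show "x = y" using ext[OF lin lin] by (intro eqI) blast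
  qed
  ultimately have "surj T" by (rule B.linear_inj_imp_surj)
  then obtain x where "T x = (\<Sum>b\<in>B. scale (f b) b)" by (metis surjD)
  then have "\<forall>b\<in>B. \<omega> x b = f b" unfolding T_def by (rule coord)
  then show ?thesis using ext[OF lin f] by blast
qed

lemma bracket_skew: "bracket u v = - bracket v u"
proof -
  have "bracket u v + bracket v u = bracket (u + v) (u + v)"
    unfolding linear_facts(5,6) by (simp add: bracket_self add.commute)
  also have "\<dots> = 0" by (rule bracket_self)
  finally show ?thesis unfolding eq_neg_iff_add_eq_0 .
qed

lemma form_minus: "\<omega> (- u) w = - \<omega> u w"
  using form_diff[of 0 u w] form_diff[of 0 0 w] by simp

lemma levi_civita_product_iff:
  "is_levi_civita_product scale bracket \<omega> p \<longleftrightarrow>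
   (\<forall>u v w. 2 * \<omega> (p u v) w = \<omega> (bracket u v) w - \<omega> (bracket v w) u + \<omega> (bracket w u) v)"
  (is "_ \<longleftrightarrow> ?K")
proof
  assume p: "is_levi_civita_product scale bracket \<omega> p"
  then have t: "\<And>u v w. \<omega> (bracket u v) w = \<omega> (p u v) w - \<omega> (p v u) w"
    and m: "\<And>u v w. \<omega> (p u v) w = - \<omega> (p u w) v"
    unfolding is_levi_civita_product_def by (metis form_diff, metis skew)
  show ?K
  proof (intro allI)
    fix u v w
    show "2 * \<omega> (p u v) w = \<omega> (bracket u v) w - \<omega> (bracket v w) u + \<omega> (bracket w u) v"
      unfolding t m[of v u w] m[of w v u] m[of u w v] mult_2 by simp
  qed
next
  assume K: ?K
  have half: "\<omega> x w = \<omega> y w" if "2 * \<omega> x w = 2 * \<omega> y w" for x y w using that by simp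
  have bsk: "\<omega> (bracket a b) c = - \<omega> (bracket b a) c" for a b c
    by (metis bracket_skew form_minus)
  have "\<omega> (p u v) w = \<omega> v (p u w)" for u v w
  proof -
    have "2 * \<omega> (p u v) w = - (2 * \<omega> (p u w) v)"
      using K[rule_format, of u v w] K[rule_format, of u w v]
        bsk[of u v w] bsk[of v w u] bsk[of w u v] by simp
    then have "\<omega> (p u v) w = - \<omega> (p u w) v"
      by (metis mult_cancel_left mult_minus_right zero_neq_numeral)
    then show ?thesis by (metis skew)
  qed
  moreover have "p u v - p v u = bracket u v" for u v
  proof (rule eqI)
    fix w
    have "2 * \<omega> (p u v - p v u) w = 2 * \<omega> (bracket u v) w"
      using K[rule_format, of u v w] K[rule_format, of v u w]
        bsk[of u v w] bsk[of v w u] bsk[of w u v]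
      by (simp add: form_diff right_diff_distrib)
    then show "\<omega> (p u v - p v u) w = \<omega> (bracket u v) w" by simp
  qed
  moreover have "p (a + b) v = p a v + p b v" "p v (a + b) = p v a + p v b"
    "p (scale c a) v = scale c (p a v)" "p v (scale c a) = scale c (p v a)" for a b c v
    by (rule eqI, rule half,
      simp only: K[rule_format] linear_facts distrib_left mult.left_commute[of 2],
      simp add: algebra_simps)+
  then have "bilinear_map scale scale scale p"
    using vector_space_axioms
    by (auto simp: bilinear_map_def Vector_Spaces.linear_def module_hom_def module_hom_axioms_def
        module_iff_vector_space)
  ultimately show "is_levi_civita_product scale bracket \<omega> p"
    by (simp add: is_levi_civita_product_def)
qed

lemma ex1_levi_civita_product: "\<exists>!p. is_levi_civita_product scale bracket \<omega> p"
proof -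
  have "\<exists>x. \<forall>w. \<omega> x w = (\<omega> (bracket u v) w - \<omega> (bracket v w) u + \<omega> (bracket w u) v) / 2" for u v
    by (rule riesz, rule linearI) (simp_all add: linear_facts field_simps)
  then obtain p where
    p: "\<And>u v w. \<omega> (p u v) w = (\<omega> (bracket u v) w - \<omega> (bracket v w) u + \<omega> (bracket w u) v) / 2"
    by metis
  show ?thesis
  proof (rule ex1I[of _ p])
    show "is_levi_civita_product scale bracket \<omega> p"
      unfolding levi_civita_product_iff by (simp add: p)
  next
    fix q assume "is_levi_civita_product scale bracket \<omega> q"
    then have "2 * \<omega> (q u v) w = 2 * \<omega> (p u v) w" for u v w
      unfolding levi_civita_product_iff by (simp add: p)
    then show "q = p" by (intro ext eqI) simp
  qed
qed

lemma ex1_left_symmetric_product: "\<exists>!p. \<forall>u v w. \<omega> (p u v) w = - \<omega> v (bracket u w)"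
proof -
  have "\<exists>x. \<forall>w. \<omega> x w = - \<omega> v (bracket u w)" for u v
    by (rule riesz, rule linearI) (simp_all add: linear_facts)
  then have "\<omega> (SOME x. \<forall>w. \<omega> x w = - \<omega> v (bracket u w)) w = - \<omega> v (bracket u w)" for u v w
    by (rule someI_ex[THEN spec])
  then obtain p where p: "\<forall>u v w. \<omega> (p u v) w = - \<omega> v (bracket u w)"
    by (intro that[of "\<lambda>u v. SOME x. \<forall>w. \<omega> x w = - \<omega> v (bracket u w)"]) blast
  show ?thesis
    using p by (intro ex1I[of _ p] ext eqI) simp_all
qed

end

end

theory Submission
  imports Defs
begin

text \<open>Closedness of \<open>\<omega>\<close> collapses the three terms of the Koszul formula for the Levi-Civita
  product \<open>\<bullet>\<close> to a single one, \<open>\<omega> (u \<bullet> v) w = \<omega> u [v, w]\<close>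
  (\<open>form_levi_civita_product\<close>). In other words, right multiplication \<open>R\<^sub>v\<close> by \<open>v\<close> is the
  \<open>\<omega>\<close>-adjoint of \<open>ad v\<close>, whereas left multiplication by \<open>v\<close> for the left-symmetric product is
  minus this adjoint; this is the second claim.

  Taking adjoints reverses composition, and \<open>ad\<close> is a representation by the Jacobi identity, so
  \<open>R\<close> is an anti-representation: \<open>R\<^sub>w R\<^sub>v - R\<^sub>v R\<^sub>w = R\<^bsub>[v, w]\<^esub>\<close>
  (\<open>right_mult_anti_representation\<close>). Since \<open>\<bullet>\<close> is torsion-free, \<open>[v, w] = v \<bullet> w - w \<bullet> v\<close>, and
  substituting this turns the identity into \<open>(u, v, w) = (u, w, v)\<close> for the associator.\<close>

lemma (in lie_algebra_with_skew_form) form_diff_right: "\<omega> u (v - w) = \<omega> u v - \<omega> u w"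
  using linear_facts(2)[of u "v - w" w] by (simp add: algebra_simps)

lemma (in lie_algebra_with_skew_form) ad_bracket:
  "bracket (bracket v w) z = bracket v (bracket w z) - bracket w (bracket v z)"
proof -
  have "bracket z v + bracket v z = 0" and "bracket w 0 = 0"
    using bracket_skew[of z v] linear_facts(6)[of w 0 0] by simp_all
  then have "bracket w (bracket z v) = - bracket w (bracket v z)"
    by (metis linear_facts(6) eq_neg_iff_add_eq_0)
  with jacobi[of v w z] bracket_skew[of z "bracket v w"] show ?thesis
    by (simp add: algebra_simps)
qed

context symplectic_lie_algebra
begin

abbreviation lc :: "'v \<Rightarrow> 'v \<Rightarrow> 'v"  (infixl \<open>\<bullet>\<close> 70)
  where "u \<bullet> v \<equiv> levi_civita_product scale bracket \<omega> u v"

lemma is_levi_civita_product_lc: "is_levi_civita_product scale bracket \<omega> (\<bullet>)"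
  unfolding levi_civita_product_def by (rule theI'[OF ex1_levi_civita_product])

lemma lc_bilinear: "bilinear_map scale scale scale (\<bullet>)"
  and lc_torsion_free: "u \<bullet> v - v \<bullet> u = bracket u v"
  using is_levi_civita_product_lc by (simp_all add: is_levi_civita_product_def)

lemma lc_diff_right: "u \<bullet> (v - w) = u \<bullet> v - u \<bullet> w"
proof -
  have "u \<bullet> (v - w + w) = u \<bullet> (v - w) + u \<bullet> w"
    using lc_bilinear unfolding bilinear_map_def Vector_Spaces.linear_def module_hom_def
      module_hom_axioms_def by blast
  then show ?thesis by (simp add: algebra_simps)
qed

text \<open>By closedness the first and the third term of the Koszul formula add up to
  \<open>- \<omega> [v, w] u\<close>, a second copy of the middle term; the factor 2 then cancels.\<close>

lemma form_levi_civita_product: "\<omega> (u \<bullet> v) w = \<omega> u (bracket v w)"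
proof -
  have "2 * \<omega> (u \<bullet> v) w = \<omega> (bracket u v) w - \<omega> (bracket v w) u + \<omega> (bracket w u) v"
    using is_levi_civita_product_lc unfolding levi_civita_product_iff by blast
  also have "\<dots> = 2 * (- \<omega> (bracket v w) u)"
    using closed[of u v w] by (simp add: algebra_simps eq_neg_iff_add_eq_0)
  finally have "\<omega> (u \<bullet> v) w = - \<omega> (bracket v w) u"
    by (metis mult_cancel_left zero_neq_numeral)
  then show ?thesis by (metis skew)
qed

lemma form_left_symmetric_product:
  "\<omega> (left_symmetric_product bracket \<omega> u v) w = - \<omega> v (bracket u w)"
  using theI'[OF ex1_left_symmetric_product] unfolding left_symmetric_product_def by blast

lemma levi_civita_product_eq_neg_left_symmetric_product:
  "u \<bullet> v = - left_symmetric_product bracket \<omega> v u"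
  by (rule eqI) (simp add: form_minus form_left_symmetric_product form_levi_civita_product)

text \<open>Moving the two right multiplications across \<open>\<omega>\<close> turns the left-hand side into the
  commutator of \<open>ad v\<close> and \<open>ad w\<close>, which is \<open>ad [v, w]\<close>.\<close>

lemma right_mult_anti_representation: "(u \<bullet> v) \<bullet> w - (u \<bullet> w) \<bullet> v = u \<bullet> bracket v w"
  by (rule eqI) (simp add: form_diff form_levi_civita_product ad_bracket form_diff_right)

lemma right_symmetric_levi_civita_product: "right_symmetric_algebra scale (\<bullet>)"
proof
  show "\<exists>B. finite_dimensional_vector_space scale B" by (rule finite_dim)
  show "bilinear_map scale scale scale (\<bullet>)" by (rule lc_bilinear)
  fix u v w
  have "(u \<bullet> v) \<bullet> w - (u \<bullet> w) \<bullet> v = u \<bullet> (v \<bullet> w) - u \<bullet> (w \<bullet> v)"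
    by (simp only: right_mult_anti_representation lc_torsion_free flip: lc_diff_right)
  then show "associator (\<bullet>) u v w = associator (\<bullet>) u w v"
    by (simp add: associator_def algebra_simps)
qed

end

theorem proposition3p1:
  fixes scale :: "'k::field_char_0 \<Rightarrow> 'v::ab_group_add \<Rightarrow> 'v"
    and bracket :: "'v \<Rightarrow> 'v \<Rightarrow> 'v" and \<omega> :: "'v \<Rightarrow> 'v \<Rightarrow> 'k"
  assumes "symplectic_lie_algebra scale bracket \<omega>"
  shows "(\<forall>u v w. \<omega> (levi_civita_product scale bracket \<omega> u v) w = \<omega> u (bracket v w)) \<and>
    (\<forall>u v. levi_civita_product scale bracket \<omega> u v = - left_symmetric_product bracket \<omega> v u) \<and>
    right_symmetric_algebra scale (levi_civita_product scale bracket \<omega>)"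
proof -
  interpret symplectic_lie_algebra scale bracket \<omega> by (rule assms)
  show ?thesis
    using form_levi_civita_product levi_civita_product_eq_neg_left_symmetric_product
      right_symmetric_levi_civita_product by blast
qed

end
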